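(* Let $A$ be the associative triple system of $2\times2$ matrices over a field $F$ of characteristic $0$, and let $U(A^{C})$ and $U(A^{CT})$ be the universal associative enveloping algebras of $A$ with respect to the special commutator and with respect to the special commutator and special translator together. Then $U(A^{CT})\cong U(A^{C})$.
   Context: $A=M_2(F)$ with triple product the ordinary matrix product $xyz$; special commutator $[x,y,z]=xyz-yxz$ and special translator $\langle x,y,z\rangle=xyz-yzx$. Let $E_{ij}$ ($1\le i,j\le2$) be the matrix units, $X=\{e_{ij}\mid1\le i,j\le2\}$ a set of symbols, $F\langle X\rangle$ the free unital associative algebra on $X$, and $\eta\colon A\to F\langle X\rangle$ the linear map with $\eta(E_{ij})=e_{ij}$. Let $$G^C=\{e_{ij}e_{kl}e_{st}-e_{kl}e_{ij}e_{st}-\eta([E_{ij},E_{kl},E_{st}])\},\qquad G^T=\{e_{ij}e_{kl}e_{st}-e_{kl}e_{st}e_{ij}-\eta(\langle E_{ij},E_{kl},E_{st}\rangle)\},$$ with all indices ranging over $\{1,2\}$, and $G^{CT}=G^C\cup G^T$. Then $U(A^C)=F\langle X\rangle/I^C$ and $U(A^{CT})=F\langle X\rangle/I^{CT}$, where $I^C$ and $I^{CT}$ are the two-sided ideals generated by $G^C$ and $G^{CT}$. *)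

theory Defs
  imports
    "HOL-Analysis.Analysis"
    "HOL-Library.Poly_Mapping"
    "HOL-Algebra.QuotRing"
    "HOL-Algebra.Module"
begin

text \<open>
  Words over an alphabet form a monoid under concatenation. It is written additively because
  \<^typ>\<open>'m \<Rightarrow>\<^sub>0 'f\<close> is the monoid algebra over \<open>'f\<close> of an additively written monoid \<open>'m\<close>.
  Hence \<^typ>\<open>'x list \<Rightarrow>\<^sub>0 'f\<close> is the free unital associative algebra on \<open>'x\<close>.
\<close>

instantiation list :: (type) monoid_add
begin

definition zero_list :: "'a list" where "0 = []"

definition plus_list :: "'a list \<Rightarrow> 'a list \<Rightarrow> 'a list" where "u + v = u @ v"

instance
  by standard (simp_all add: zero_list_def plus_list_def)

end

type_synonym ('x, 'f) free_assoc = "'x list \<Rightarrow>\<^sub>0 'f"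

definition letter :: "'x \<Rightarrow> ('x, 'f::ring_1) free_assoc"
  where "letter x = Poly_Mapping.single [x] 1"

definition scalar_mult :: "'f \<Rightarrow> ('x, 'f::ring_1) free_assoc \<Rightarrow> ('x, 'f) free_assoc"
  where "scalar_mult c p = Poly_Mapping.map (\<lambda>a. c * a) p"

definition free_algebra :: "('f::ring_1, ('x, 'f) free_assoc) module"
  where "free_algebra =
    \<lparr>carrier = UNIV, mult = (*), one = 1, zero = 0, add = (+), smult = scalar_mult\<rparr>"

lemma free_algebra_smult: "c \<odot>\<^bsub>free_algebra\<^esub> p = scalar_mult c p"
  by (simp add: free_algebra_def)

lemma ring_free_algebra: "ring free_algebra"
proof (rule ringI)
  show "abelian_group free_algebra"
  proof (rule abelian_groupI)
    show "\<exists>y\<in>carrier free_algebra. y \<oplus>\<^bsub>free_algebra\<^esub> x = \<zero>\<^bsub>free_algebra\<^esub>"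
      if "x \<in> carrier free_algebra" for x :: "('x, 'f::ring_1) free_assoc"
      by (rule bexI[of _ "- x"]) (simp_all add: free_algebra_def)
  qed (simp_all add: free_algebra_def ac_simps)
  show "Group.monoid free_algebra"
    by (rule Group.monoidI) (auto simp: free_algebra_def mult.assoc)
qed (auto simp: free_algebra_def distrib_left distrib_right)

lemma scalar_mult_eq_times: "scalar_mult c p = Poly_Mapping.single [] c * p"
proof -
  have "scalar_mult c p = Poly_Mapping.single 0 c * p"
    by (simp add: scalar_mult_def mult_map_scale_conv_mult)
  thus ?thesis by (simp add: zero_list_def)
qed

text \<open>
  The quotient of an algebra by a two-sided ideal: the quotient ring of the library, extended by
  the scalar multiplication induced on cosets (in the same style as \<^const>\<open>rcoset_mult\<close>).
\<close>

definition quotient_algebra :: "('f, 'a) module \<Rightarrow> 'a set \<Rightarrow> ('f, 'a set) module"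
  where "quotient_algebra R I =
    ring.extend (R Quot I)
      (module.fields (\<lambda>c C. \<Union>x\<in>C. I +>\<^bsub>R\<^esub> (c \<odot>\<^bsub>R\<^esub> x)))"

lemma quotient_algebra_smult:
  assumes "ideal I free_algebra"
  shows "c \<odot>\<^bsub>quotient_algebra free_algebra I\<^esub> (I +>\<^bsub>free_algebra\<^esub> x)
    = I +>\<^bsub>free_algebra\<^esub> (scalar_mult c x)"
proof -
  interpret ideal I free_algebra by fact
  have coset: "I +>\<^bsub>free_algebra\<^esub> y = (\<lambda>h. h + y) ` I" for y
    by (auto simp: a_r_coset_def r_coset_def free_algebra_def)
  have "I +>\<^bsub>free_algebra\<^esub> (scalar_mult c y) = I +>\<^bsub>free_algebra\<^esub> (scalar_mult c x)"
    if y: "y \<in> I +>\<^bsub>free_algebra\<^esub> x" for y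
  proof -
    obtain h where h: "h \<in> I" "y = h + x" using y by (auto simp: coset)
    have "scalar_mult c h \<in> I"
      using I_l_closed[of h "Poly_Mapping.single [] c"] h(1)
      by (simp add: scalar_mult_eq_times free_algebra_def)
    moreover have "scalar_mult c y = scalar_mult c h + scalar_mult c x"
      by (simp add: h(2) scalar_mult_eq_times distrib_left)
    ultimately have "scalar_mult c y \<in> I +>\<^bsub>free_algebra\<^esub> scalar_mult c x" by (auto simp: coset)
    thus ?thesis
      by (intro a_repr_independence'[symmetric]) (simp_all add: free_algebra_def)
  qed
  moreover have "x \<in> I +>\<^bsub>free_algebra\<^esub> x"
    by (rule a_rcos_self) (simp add: free_algebra_def)
  ultimately have "(\<Union>y\<in>I +>\<^bsub>free_algebra\<^esub> x. I +>\<^bsub>free_algebra\<^esub> scalar_mult c y)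
      = I +>\<^bsub>free_algebra\<^esub> scalar_mult c x"
    by blast
  thus ?thesis
    by (simp add: quotient_algebra_def ring.defs module.defs free_algebra_smult)
qed

text \<open>
  Isomorphisms of unital associative algebras. All elements of the type \<open>'f\<close> are scalars.
  Members of \<^const>\<open>ring_iso\<close> preserve the unit element.
\<close>

definition algebra_iso :: "('f, 'a) module \<Rightarrow> ('f, 'b) module \<Rightarrow> ('a \<Rightarrow> 'b) set"
  where "algebra_iso R S =
    {h \<in> ring_iso R S. \<forall>c. \<forall>x\<in>carrier R. h (c \<odot>\<^bsub>R\<^esub> x) = c \<odot>\<^bsub>S\<^esub> h x}"

definition algebra_isomorphic :: "('f, 'a) module \<Rightarrow> ('f, 'b) module \<Rightarrow> bool"
    (infix \<open>\<cong>\<^sub>a\<close> 50)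
  where "R \<cong>\<^sub>a S \<longleftrightarrow> algebra_iso R S \<noteq> {}"

text \<open>The associative triple system of 2 by 2 matrices, indexed by the two-element type \<open>2\<close>.\<close>

definition triple :: "'f::field^2^2 \<Rightarrow> 'f^2^2 \<Rightarrow> 'f^2^2 \<Rightarrow> 'f^2^2"
  where "triple x y z = x ** y ** z"

definition special_commutator :: "'f::field^2^2 \<Rightarrow> 'f^2^2 \<Rightarrow> 'f^2^2 \<Rightarrow> 'f^2^2"
  where "special_commutator x y z = triple x y z - triple y x z"

definition special_translator :: "'f::field^2^2 \<Rightarrow> 'f^2^2 \<Rightarrow> 'f^2^2 \<Rightarrow> 'f^2^2"
  where "special_translator x y z = triple x y z - triple y z x"

definition matrix_unit :: "2 \<Rightarrow> 2 \<Rightarrow> 'f::field^2^2"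
  where "matrix_unit i j = (\<chi> r s. if r = i \<and> s = j then 1 else 0)"

text \<open>The pair \<open>(i, j)\<close> serves as the index of the symbol \<open>e\<^sub>i\<^sub>j\<close>.\<close>

definition gen :: "2 \<Rightarrow> 2 \<Rightarrow> (2 \<times> 2, 'f::field) free_assoc"
  where "gen i j = letter (i, j)"

definition eta :: "'f::field^2^2 \<Rightarrow> (2 \<times> 2, 'f) free_assoc"
  where "eta M = (\<Sum>i\<in>UNIV. \<Sum>j\<in>UNIV. scalar_mult (M $ i $ j) (gen i j))"

lemma eta_matrix_unit: "eta (matrix_unit i j :: 'f::field^2^2) = gen i j"
proof -
  have "scalar_mult ((matrix_unit i j :: 'f^2^2) $ r $ s) (gen r s)
      = (if r = i then if s = j then gen r s else 0 else 0)" for r s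
    by (simp add: matrix_unit_def scalar_mult_def mult_map_scale_conv_mult)
  moreover have "(\<Sum>s\<in>UNIV. if r = i then if s = j then gen r s else 0 else 0)
      = (if r = i then gen r j :: (2 \<times> 2, 'f) free_assoc else 0)" for r
    by simp
  ultimately show ?thesis by (simp add: eta_def)
qed

definition G_C :: "(2 \<times> 2, 'f::field) free_assoc set"
  where "G_C = {gen i j * gen k l * gen s t - gen k l * gen i j * gen s t
      - eta (special_commutator (matrix_unit i j) (matrix_unit k l) (matrix_unit s t))
    | i j k l s t. True}"

definition G_T :: "(2 \<times> 2, 'f::field) free_assoc set"
  where "G_T = {gen i j * gen k l * gen s t - gen k l * gen s t * gen i j
      - eta (special_translator (matrix_unit i j) (matrix_unit k l) (matrix_unit s t))
    | i j k l s t. True}"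

definition G_CT :: "(2 \<times> 2, 'f::field) free_assoc set"
  where "G_CT = G_C \<union> G_T"

definition I_C :: "(2 \<times> 2, 'f::field) free_assoc set"
  where "I_C = Idl\<^bsub>free_algebra\<^esub> G_C"

definition I_CT :: "(2 \<times> 2, 'f::field) free_assoc set"
  where "I_CT = Idl\<^bsub>free_algebra\<^esub> G_CT"

definition U_C :: "('f::field, (2 \<times> 2, 'f) free_assoc set) module"
  where "U_C = quotient_algebra free_algebra I_C"

definition U_CT :: "('f::field, (2 \<times> 2, 'f) free_assoc set) module"
  where "U_CT = quotient_algebra free_algebra I_CT"

end

theory Submission
  imports Defs
begin

text \<open>
  The two ideals coincide, so the identity map is an isomorphism. The reason is that already
  modulo \<^const>\<open>I_C\<close> the map \<^const>\<open>eta\<close> is multiplicative on triples: the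
  \<^emph>\<open>defect\<close> \<open>D(a, b, c) = \<eta>(a) \<eta>(b) \<eta>(c) - \<eta>(abc)\<close> vanishes for all matrices
  (\<open>defect_mem\<close>). A translator relation is the difference of a defect and its cyclic shift, so it
  vanishes as well.

  Write \<open>s = ab - ba\<close>. By trilinearity, the commutator relations say, modulo the ideal, that
  \<open>D(a, b, c) = D(b, a, c)\<close> for all matrices, and equivalently that
  \<open>[\<eta>(a), \<eta>(b)] \<eta>(c) = \<eta>(sc)\<close>. Reducing
  \<open>[\<eta>(a), \<eta>(b)] [\<eta>(c), \<eta>(d)] \<eta>(f)\<close> once from the left and once from the right gives
  \<open>D(sc, d, f) = D(sd, c, f)\<close>. With the symmetry this becomes the adjunction
  \<open>D(su, v, f) = D(u, sv, f)\<close> (\<open>defect_commutator_adjoint\<close>): every commutator of matrices acts as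
  a self-adjoint operator for the bilinear map \<open>D(_, _, f)\<close>.

  But commutators are closed under the bracket, and the bracket \<open>h = st - ts\<close> of two self-adjoint
  operators is skew-adjoint. Being a commutator itself, \<open>h\<close> is both, which forces
  \<open>2 D(u, hv, f) = 0\<close>. In characteristic 0 the factor 2 cancels, and for \<open>s = E\<^sub>1\<^sub>2\<close>,
  \<open>t = E\<^sub>2\<^sub>1\<close> the matrix \<open>h = E\<^sub>1\<^sub>1 - E\<^sub>2\<^sub>2\<close> is invertible, so \<open>D\<close> vanishes.
\<close>

section \<open>Trilinearity of the defect\<close>

text \<open>
  A scalar \<open>x\<close> is represented by the matrix \<^term>\<open>mat x\<close> on one side of \<^const>\<open>eta\<close> and by
  the multiple \<^term>\<open>Poly_Mapping.single [] x\<close> of the empty word on the other, so that scalar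
  multiplication is multiplication in both rings.
\<close>

lemma mat_mult_nth: "(mat x ** M) $ i $ j = (x :: 'f::comm_ring_1) * M $ i $ j"
  by (simp add: matrix_matrix_mult_def mat_def if_distrib[of "\<lambda>a. a * _"] cong: if_cong)

lemma matrix_mult_mat_left_commute:
  "M ** (mat x ** N) = mat x ** (M ** (N :: 'f::comm_ring_1^'n^'m))"
  by (simp add: vec_eq_iff mat_mult_nth matrix_matrix_mult_def[of M] sum_distrib_left
      mult.left_commute)

lemma matrix_add_mult: "(M + N) ** P = M ** P + N ** (P :: 'f::comm_ring_1^'n^'m)"
  by (simp add: vec_eq_iff matrix_matrix_mult_def algebra_simps sum.distrib)

lemma matrix_diff_mult: "(M - N) ** P = M ** P - N ** (P :: 'f::comm_ring_1^'n^'m)"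
  by (simp add: vec_eq_iff matrix_matrix_mult_def algebra_simps sum_subtractf)

lemma matrix_mult_diff: "P ** (M - N) = P ** M - P ** (N :: 'f::comm_ring_1^'n^'m)"
  by (simp add: vec_eq_iff matrix_matrix_mult_def algebra_simps sum_subtractf)

lemma single_Nil_mult:
  "Poly_Mapping.single [] x * Poly_Mapping.single [] y = Poly_Mapping.single [] (x * y)"
  by (simp add: mult_single plus_list_def)

lemma single_Nil_left_commute:
  "Poly_Mapping.single [] x * (Poly_Mapping.single [] y * p)
    = Poly_Mapping.single [] y * (Poly_Mapping.single [] (x :: 'f::field) * p)"
  by (simp add: single_Nil_mult mult.commute flip: mult.assoc)

lemma eta_add: "eta (M + N) = eta M + eta N"
  by (simp add: eta_def scalar_mult_eq_times single_add distrib_right sum.distrib)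

lemma eta_diff: "eta (M - N) = eta M - eta N"
  using eta_add[of "M - N" N] by simp

lemma eta_mat_mult: "eta (mat x ** M) = Poly_Mapping.single [] x * eta M"
  by (simp add: eta_def mat_mult_nth scalar_mult_eq_times sum_distrib_left single_Nil_mult
      flip: mult.assoc)

lemma eta_mult_single_Nil: "eta M * Poly_Mapping.single [] x = Poly_Mapping.single [] x * eta M"
  by (simp add: eta_def scalar_mult_eq_times gen_def letter_def mult_single plus_list_def
      sum_distrib_left sum_distrib_right mult.commute)

lemma eta_mult_single_Nil_left:
  "eta M * (Poly_Mapping.single [] x * p) = Poly_Mapping.single [] x * (eta M * p)"
  by (simp add: eta_mult_single_Nil flip: mult.assoc)

text \<open>
  This reduces a multilinear claim to the matrix units, one argument at a time.
\<close>

lemma matrix_unit_induct [case_names scaled_unit add]: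
  fixes M :: "'f::field^2^2"
  assumes unit: "\<And>x i j. P (mat x ** matrix_unit i j)"
    and add: "\<And>M N. P M \<Longrightarrow> P N \<Longrightarrow> P (M + N)"
  shows "P M"
proof -
  have "M = (mat (M $ 1 $ 1) ** matrix_unit 1 1 + mat (M $ 1 $ 2) ** matrix_unit 1 2)
      + (mat (M $ 2 $ 1) ** matrix_unit 2 1 + mat (M $ 2 $ 2) ** matrix_unit 2 2)"
    by (simp add: vec_eq_iff forall_2 mat_mult_nth matrix_unit_def)
  moreover have "P \<dots>" by (intro add unit)
  ultimately show ?thesis by simp
qed

definition defect :: "'f::field^2^2 \<Rightarrow> 'f^2^2 \<Rightarrow> 'f^2^2 \<Rightarrow> (2 \<times> 2, 'f) free_assoc"
  where "defect a b c = eta a * eta b * eta c - eta (a ** b ** c)"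

lemma defect_add:
  "defect (a + a') b c = defect a b c + defect a' b c"
  "defect a (b + b') c = defect a b c + defect a b' c"
  "defect a b (c + c') = defect a b c + defect a b c'"
  by (simp_all add: defect_def eta_add matrix_add_ldistrib matrix_add_mult algebra_simps)

lemma defect_diff:
  "defect (a - a') b c = defect a b c - defect a' b c"
  "defect a (b - b') c = defect a b c - defect a b' c"
  using defect_add(1)[of "a - a'" a' b c] defect_add(2)[of a "b - b'" b' c]
  by (simp_all add: eq_diff_eq)

lemma defect_mat_mult:
  "defect (mat x ** a) b c = Poly_Mapping.single [] x * defect a b c"
  "defect a (mat x ** b) c = Poly_Mapping.single [] x * defect a b c"
  "defect a b (mat x ** c) = Poly_Mapping.single [] x * defect a b c"
  by (simp_all add: defect_def eta_mat_mult right_diff_distrib matrix_mult_mat_left_commute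
      mult.assoc eta_mult_single_Nil_left flip: matrix_mul_assoc)

section \<open>Ideals containing the commutator relations\<close>

locale commutator_ideal =
  fixes I :: "(2 \<times> 2, 'f::field_char_0) free_assoc set"
  assumes ideal: "ideal I free_algebra"
    and G_C_subset: "G_C \<subseteq> I"
begin

lemma mult_left_mem: "p \<in> I \<Longrightarrow> q * p \<in> I"
  using ideal.I_l_closed[OF ideal, of p q] by (simp add: free_algebra_def)

lemma mult_right_mem: "p \<in> I \<Longrightarrow> p * q \<in> I"
  using ideal.I_r_closed[OF ideal, of p q] by (simp add: free_algebra_def)

lemma add_mem: "p \<in> I \<Longrightarrow> q \<in> I \<Longrightarrow> p + q \<in> I"
  using additive_subgroup.a_closed[OF ideal.axioms(1)[OF ideal], of p q]
  by (simp add: free_algebra_def)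

lemma diff_mem: "p \<in> I \<Longrightarrow> q \<in> I \<Longrightarrow> p - q \<in> I"
  using add_mem[of p "- q"] mult_left_mem[of q "- 1"] by simp

text \<open>The one place where the characteristic of the field enters.\<close>

lemma half_mem:
  assumes "p + p \<in> I"
  shows "p \<in> I"
proof -
  have "Poly_Mapping.single [] (1/2 :: 'f) * (p + p)
      = (Poly_Mapping.single [] (1/2) + Poly_Mapping.single [] (1/2)) * p"
    by (simp only: distrib_left distrib_right)
  also have "\<dots> = p"
    by (simp add: single_add[symmetric] flip: zero_list_def)
  finally show ?thesis using mult_left_mem[OF assms] by metis
qed

text \<open>
  For matrix units this is a generator: the products inside \<^const>\<open>special_commutator\<close> match the
  \<^const>\<open>eta\<close>-terms of the two defects. Both sides are trilinear.
\<close>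

lemma defect_swap: "defect a b c - defect b a c \<in> I"
proof -
  have unit: "defect (matrix_unit i j) (matrix_unit k l) (matrix_unit s t)
      - defect (matrix_unit k l) (matrix_unit i j) (matrix_unit s t) \<in> I" for i j k l s t
  proof -
    have "gen i j * gen k l * gen s t - gen k l * gen i j * gen s t
      - eta (special_commutator (matrix_unit i j) (matrix_unit k l) (matrix_unit s t)) \<in> I"
      using G_C_subset unfolding G_C_def by blast
    then show ?thesis
      by (simp add: defect_def special_commutator_def triple_def eta_diff eta_matrix_unit
          algebra_simps)
  qed
  have scale: "Poly_Mapping.single [] x * p - Poly_Mapping.single [] x * q \<in> I"
    if "p - q \<in> I" for x p q
    using mult_left_mem[OF that] by (simp add: right_diff_distrib)
  have plus: "(p + p') - (q + q') \<in> I" if "p - q \<in> I" "p' - q' \<in> I" for p p' q q'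
    using add_mem[OF that] by (simp add: algebra_simps)
  show ?thesis
  proof (induction a rule: matrix_unit_induct)
    case (scaled_unit x i j)
    show ?case
    proof (induction b rule: matrix_unit_induct)
      case (scaled_unit y k l)
      show ?case
      proof (induction c rule: matrix_unit_induct)
        case (scaled_unit z s t)
        from scale[OF scale[OF scale[OF unit]]]
        have "Poly_Mapping.single [] x * (Poly_Mapping.single [] y * (Poly_Mapping.single [] z *
            defect (matrix_unit i j) (matrix_unit k l) (matrix_unit s t)))
          - Poly_Mapping.single [] x * (Poly_Mapping.single [] y * (Poly_Mapping.single [] z *
            defect (matrix_unit k l) (matrix_unit i j) (matrix_unit s t))) \<in> I" .
        then show ?case by (simp only: defect_mat_mult single_Nil_left_commute)
      qed (simp only: defect_add plus)
    qed (simp only: defect_add plus)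
  qed (simp only: defect_add plus)
qed

lemma commutator_mult_eta:
  "(eta a * eta b - eta b * eta a) * eta c - eta ((a ** b - b ** a) ** c) \<in> I"
  using defect_swap[of a b c]
  by (simp add: defect_def eta_diff matrix_diff_mult algebra_simps)

text \<open>
  Overlapping two commutator relations in \<open>[\<eta>(a), \<eta>(b)] [\<eta>(c), \<eta>(d)] \<eta>(f)\<close>: the left
  commutator may absorb the letters \<open>\<eta>(c)\<close> and \<open>\<eta>(d)\<close>, which leaves a difference of two products
  of three letters, or the right commutator may first absorb \<open>\<eta>(f)\<close>, which reduces everything to a
  single letter. The single letters agree with the \<^const>\<open>eta\<close>-terms of the two defects.
\<close>

lemma defect_commutator_exchange:
  fixes a b :: "'f^2^2"
  defines "s \<equiv> a ** b - b ** a"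
  shows "defect (s ** c) d f - defect (s ** d) c f \<in> I"
proof -
  define k where "k = eta a * eta b - eta b * eta a"
  have k: "k * eta c - eta (s ** c) \<in> I" for c
    unfolding k_def s_def by (rule commutator_mult_eta)
  define w where "w = (c ** d - d ** c) ** f"
  (* The right commutator absorbs f, and then the left one absorbs the resulting letter. *)
  have "k * (eta c * eta d - eta d * eta c) * eta f - k * eta w \<in> I"
    using mult_left_mem[OF commutator_mult_eta[of c d f], of k]
    by (simp only: w_def right_diff_distrib[of k "_ * eta f"] mult.assoc[of k])
  from add_mem[OF this k[of w]]
  have product: "k * (eta c * eta d - eta d * eta c) * eta f - eta (s ** w) \<in> I" by simp
  (* The left commutator absorbs c and d. *)
  have "(k * eta c - eta (s ** c)) * (eta d * eta f)
      - (k * eta d - eta (s ** d)) * (eta c * eta f) \<in> I"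
    by (intro diff_mem mult_right_mem k)
  from diff_mem[OF product this] show ?thesis
    by (simp add: defect_def w_def eta_diff matrix_diff_mult matrix_mult_diff matrix_mul_assoc
        algebra_simps)
qed

lemma defect_commutator_adjoint:
  fixes a b :: "'f^2^2"
  defines "s \<equiv> a ** b - b ** a"
  shows "defect (s ** u) v f - defect u (s ** v) f \<in> I"
  using add_mem[OF defect_commutator_exchange[of a b u v f] defect_swap[of "s ** v" u f]]
  by (simp add: s_def)

text \<open>
  The operators \<open>s\<close>, \<open>t\<close> and \<open>h = st - ts\<close> below are all commutators, hence self-adjoint for the
  defect, while the bracket \<open>h\<close> is skew-adjoint. Since \<open>h\<close> is an involution, its image contains
  every matrix.
\<close>

lemma defect_mem: "defect u v f \<in> I"
proof -
  define s t h :: "'f^2^2"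
    where "s = matrix_unit 1 2" and "t = matrix_unit 2 1" and "h = s ** t - t ** s"
  have s: "s = matrix_unit 1 1 ** s - s ** matrix_unit 1 1"
    by (simp add: s_def vec_eq_iff forall_2 matrix_matrix_mult_def sum_2 matrix_unit_def)
  have t: "t = matrix_unit 2 2 ** t - t ** matrix_unit 2 2"
    by (simp add: t_def vec_eq_iff forall_2 matrix_matrix_mult_def sum_2 matrix_unit_def)
  have hh: "h ** h = mat 1"
    by (simp add: h_def s_def t_def vec_eq_iff forall_2 matrix_matrix_mult_def sum_2
        matrix_unit_def mat_def)
  have s_adj: "defect (s ** u) v f - defect u (s ** v) f \<in> I" for u v
    using defect_commutator_adjoint[of "matrix_unit 1 1" s u v f] by (simp flip: s)
  have t_adj: "defect (t ** u) v f - defect u (t ** v) f \<in> I" for u v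
    using defect_commutator_adjoint[of "matrix_unit 2 2" t u v f] by (simp flip: t)
  have h_adj: "defect (h ** u) v f - defect u (h ** v) f \<in> I" for v
    using defect_commutator_adjoint[of s t u v f] by (simp add: h_def)
  have vanish: "defect u (h ** v) f \<in> I" for v
  proof -
    have "defect (s ** (t ** u)) v f - defect u (t ** (s ** v)) f \<in> I"
      using add_mem[OF s_adj[of "t ** u" v] t_adj[of u "s ** v"]] by simp
    moreover have "defect (t ** (s ** u)) v f - defect u (s ** (t ** v)) f \<in> I"
      using add_mem[OF t_adj[of "s ** u" v] s_adj[of u "t ** v"]] by simp
    (* Moving st across reverses the order of the factors, so h turns into -h. *)
    ultimately have "(defect (s ** (t ** u)) v f - defect u (t ** (s ** v)) f)
        - (defect (t ** (s ** u)) v f - defect u (s ** (t ** v)) f) \<in> I"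
      by (rule diff_mem)
    also have "(defect (s ** (t ** u)) v f - defect u (t ** (s ** v)) f)
        - (defect (t ** (s ** u)) v f - defect u (s ** (t ** v)) f)
        = defect (h ** u) v f + defect u (h ** v) f"
      by (simp add: h_def matrix_diff_mult defect_diff matrix_mul_assoc)
    finally have "defect (h ** u) v f + defect u (h ** v) f \<in> I" .
    from diff_mem[OF this h_adj[of v]]
    have "defect u (h ** v) f + defect u (h ** v) f \<in> I" by simp
    then show ?thesis by (rule half_mem)
  qed
  show ?thesis using vanish[of "h ** v"] by (simp add: matrix_mul_assoc hh)
qed

lemma G_T_subset: "G_T \<subseteq> I"
proof
  fix p :: "(2 \<times> 2, 'f) free_assoc"
  assume "p \<in> G_T"
  then obtain i j k l s t where "p = gen i j * gen k l * gen s t - gen k l * gen s t * gen i j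
      - eta (special_translator (matrix_unit i j) (matrix_unit k l) (matrix_unit s t))"
    unfolding G_T_def by blast
  then have "p = defect (matrix_unit i j) (matrix_unit k l) (matrix_unit s t)
      - defect (matrix_unit k l) (matrix_unit s t) (matrix_unit i j)"
    by (simp add: defect_def special_translator_def triple_def eta_diff eta_matrix_unit
        algebra_simps)
  then show "p \<in> I" by (simp add: diff_mem defect_mem)
qed

end

section \<open>The two enveloping algebras\<close>

lemma I_CT_eq_I_C: "(I_CT :: (2 \<times> 2, 'f::field_char_0) free_assoc set) = I_C"
proof
  have sub: "S \<subseteq> carrier free_algebra" for S :: "(2 \<times> 2, 'f) free_assoc set"
    by (simp add: free_algebra_def)
  have I_C: "ideal I_C (free_algebra :: ('f, (2 \<times> 2, 'f) free_assoc) module)"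
    unfolding I_C_def by (rule ring.genideal_ideal[OF ring_free_algebra sub])
  have C: "(G_C :: (2 \<times> 2, 'f) free_assoc set) \<subseteq> I_C"
    unfolding I_C_def by (rule ring.genideal_self[OF ring_free_algebra sub])
  interpret commutator_ideal "I_C :: (2 \<times> 2, 'f) free_assoc set"
    by (rule commutator_ideal.intro[OF I_C C])
  show "(I_CT :: (2 \<times> 2, 'f) free_assoc set) \<subseteq> I_C"
    unfolding I_CT_def
    by (rule ring.genideal_minimal[OF ring_free_algebra I_C]) (simp add: G_CT_def C G_T_subset)
  show "(I_C :: (2 \<times> 2, 'f) free_assoc set) \<subseteq> I_CT"
    unfolding I_CT_def I_C_def
    by (rule ring.subset_Idl_subset[OF ring_free_algebra sub]) (simp add: G_CT_def)
qed

theorem theorem7p9: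
  shows "(U_CT :: ('f::field_char_0, (2 \<times> 2, 'f) free_assoc set) module) \<cong>\<^sub>a
         (U_C :: ('f, (2 \<times> 2, 'f) free_assoc set) module)"
proof -
  have "(\<lambda>x. x) \<in> algebra_iso U_C (U_C :: ('f, (2 \<times> 2, 'f) free_assoc set) module)"
    by (simp add: algebra_iso_def ring_iso_def ring_hom_def bij_betw_def)
  then show ?thesis
    by (auto simp: algebra_isomorphic_def U_CT_def U_C_def I_CT_eq_I_C)
qed

end
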